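(* Let $\gamma\in\mathbb{R}\setminus\{0\}$, $q\in(0,\infty)$, and let $T:(0,\infty)\to[0,\infty)$ be a measurable function with $\sup_{t>0}T(t)<\infty$. For $\lambda>0$ put $E_\lambda=\{t>0: T(t)/t^{\gamma/q}>\lambda\}$. (I) If $\lim_{t\to0^+}T(t)$ exists and is finite, then $$\lim_{t\to0^+}T(t)=\gamma^{1/q}\lim_{\lambda\to+\infty}\lambda\,w_\gamma(E_\lambda)^{1/q}\quad\text{if }\gamma>0,$$ $$\lim_{t\to0^+}T(t)=(-\gamma)^{1/q}\lim_{\lambda\to0^+}\lambda\,w_\gamma(E_\lambda)^{1/q}\quad\text{if }\gamma<0.$$ (II) If $\lim_{t\to+\infty}T(t)$ exists and is finite, then $$\lim_{t\to+\infty}T(t)=\gamma^{1/q}\lim_{\lambda\to0^+}\lambda\,w_\gamma(E_\lambda)^{1/q}\quad\text{if }\gamma>0,$$ $$\lim_{t\to+\infty}T(t)=(-\gamma)^{1/q}\lim_{\lambda\to+\infty}\lambda\,w_\gamma(E_\lambda)^{1/q}\quad\text{if }\gamma<0.$$ Furthermore (without assuming the existence of either limit), $$|\gamma|^{1/q}\sup_{\lambda>0}\lambda\,w_\gamma(E_\lambda)^{1/q}\le\sup_{t>0}T(t).$$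
   Context: For $\gamma\in\mathbb{R}\setminus\{0\}$ and measurable $E\subset(0,\infty)$, $w_\gamma(E):=\int_E t^{\gamma-1}\,dt$. *)

theory Defs
  imports "HOL-Analysis.Analysis"
begin

definition w_meas :: "real \<Rightarrow> real set \<Rightarrow> ennreal" where
  "w_meas \<gamma> E = (\<integral>\<^sup>+t\<in>E. ennreal (t powr (\<gamma> - 1)) \<partial>lebesgue)"

(* Power of an extended nonnegative number, intended for p > 0 only. *)
definition ennpowr :: "ennreal \<Rightarrow> real \<Rightarrow> ennreal" where
  "ennpowr x p = (if x = \<infinity> then \<infinity> else ennreal (enn2real x powr p))"

definition level_set :: "(real \<Rightarrow> real) \<Rightarrow> real \<Rightarrow> real \<Rightarrow> real \<Rightarrow> real set" where
  "level_set T \<gamma> q l = {t. 0 < t \<and> T t / t powr (\<gamma> / q) > l}"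

(* Extended-valued because the weighted measure is; its finiteness is not presupposed. *)
definition weak_quantity :: "(real \<Rightarrow> real) \<Rightarrow> real \<Rightarrow> real \<Rightarrow> real \<Rightarrow> ennreal" where
  "weak_quantity T \<gamma> q l = ennreal l * ennpowr (w_meas \<gamma> (level_set T \<gamma> q l)) (1 / q)"

end

theory Submission
  imports Defs
begin

text \<open>The sets of all positive t with t^(\<gamma>/q) \<le> c have weighted measure c^q / \<bar>\<gamma>\<bar>
  for either sign of \<gamma>.  If T is close to L where t^(\<gamma>/q) is small (resp. large), then for
  \<lambda> large (resp. small) the level set E_\<lambda> is squeezed between such sets with c close to
  L / \<lambda>, up to a set of fixed finite measure, which the factor \<lambda> \<rightarrow> 0 kills in the
  second case.\<close>

section \<open>Sublevel sets of a power function\<close>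

definition power_sublevel :: "real \<Rightarrow> real \<Rightarrow> real \<Rightarrow> real set" where
  "power_sublevel \<gamma> q c = {t. 0 < t \<and> t powr (\<gamma> / q) \<le> c}"

lemma powr_le_iff_le_powr_pos:
  fixes x c p :: real
  assumes "x > 0" "c > 0" "p > 0"
  shows "x powr p \<le> c \<longleftrightarrow> x \<le> c powr (1 / p)"
proof -
  have "x powr p \<le> c \<longleftrightarrow> x powr p \<le> (c powr (1 / p)) powr p"
    using assms by (simp add: powr_powr)
  also have "\<dots> \<longleftrightarrow> x \<le> c powr (1 / p)"
    using assms powr_mono2[of p x "c powr (1/p)"] powr_less_mono2[of p "c powr (1/p)" x]
    by (meson less_imp_le linorder_not_le powr_ge_zero)
  finally show ?thesis .
qed

lemma powr_le_iff_ge_powr_neg: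
  fixes x c p :: real
  assumes "x > 0" "c > 0" "p < 0"
  shows "x powr p \<le> c \<longleftrightarrow> c powr (1 / p) \<le> x"
proof -
  have "x powr p \<le> c \<longleftrightarrow> x powr p \<le> (c powr (1 / p)) powr p"
    using assms by (simp add: powr_powr)
  also have "\<dots> \<longleftrightarrow> c powr (1 / p) \<le> x"
    using assms powr_mono2'[of p "c powr (1/p)" x] powr_less_mono2_neg[of p x "c powr (1/p)"]
    by (metis linorder_not_le order_less_imp_le powr_gt_zero less_numeral_extra(3))
  finally show ?thesis .
qed

lemma power_sublevel_pos:
  \<comment> \<open>Only the evaluation of the weighted measure splits by the sign of \<gamma> and
    uses these intervals; the level-set arguments keep the power form and so treat both signs at
    once.\<close>
  assumes "\<gamma> > 0" "q > 0" "c > 0"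
  shows "power_sublevel \<gamma> q c = {0<..c powr (q / \<gamma>)}"
  using powr_le_iff_le_powr_pos[of _ c "\<gamma> / q"] assms by (auto simp: power_sublevel_def)

lemma power_sublevel_neg:
  assumes "\<gamma> < 0" "q > 0" "c > 0"
  shows "power_sublevel \<gamma> q c = {c powr (q / \<gamma>)..}"
proof -
  have "0 < t" if "c powr (q / \<gamma>) \<le> t" for t
    using that assms(3) by (simp add: less_le_trans[of 0 "c powr (q / \<gamma>)"])
  then show ?thesis
    using powr_le_iff_ge_powr_neg[of _ c "\<gamma> / q"] assms
    by (auto simp: power_sublevel_def divide_neg_pos)
qed

lemma power_sublevel_nonpos: "c \<le> 0 \<Longrightarrow> power_sublevel \<gamma> q c = {}"
  by (auto simp: power_sublevel_def not_le intro: order.strict_trans1)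

lemma power_sublevel_sets: "power_sublevel \<gamma> q c \<in> sets lebesgue"
proof -
  have "power_sublevel \<gamma> q c \<in> sets borel"
    unfolding power_sublevel_def by measurable
  then show ?thesis by simp
qed

section \<open>Weighted measure of the sublevel sets\<close>

lemma w_meas_mono: "E \<subseteq> F \<Longrightarrow> w_meas \<gamma> E \<le> w_meas \<gamma> F"
  unfolding w_meas_def by (rule nn_integral_mono) (auto simp: indicator_def)

lemma w_meas_Un_le:
  assumes "E \<in> sets lebesgue" "F \<in> sets lebesgue"
  shows "w_meas \<gamma> (E \<union> F) \<le> w_meas \<gamma> E + w_meas \<gamma> F"
proof -
  have m: "(\<lambda>t. ennreal (t powr (\<gamma> - 1))) \<in> borel_measurable lebesgue"
    by (rule measurable_completion) measurable
  have "w_meas \<gamma> (E \<union> F) \<le> (\<integral>\<^sup>+t. ennreal (t powr (\<gamma> - 1)) * indicator E t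
      + ennreal (t powr (\<gamma> - 1)) * indicator F t \<partial>lebesgue)"
    unfolding w_meas_def by (rule nn_integral_mono) (auto simp: indicator_def)
  also have "\<dots> = w_meas \<gamma> E + w_meas \<gamma> F"
    unfolding w_meas_def using m assms by (intro nn_integral_add) auto
  finally show ?thesis .
qed

text \<open>For Borel \<open>E\<close> the integrand is Borel, so passing from
  \<open>lebesgue\<close> to \<open>lborel\<close> does not change its integral; there the gauge
  integral of a nonnegative function gives the nonnegative integral.\<close>

lemma w_meas_eq_has_integral:
  assumes "((\<lambda>t. t powr (\<gamma> - 1)) has_integral I) E" "E \<in> sets borel"
  shows "w_meas \<gamma> E = ennreal I"
proof -
  have "w_meas \<gamma> E = (\<integral>\<^sup>+t. ennreal (indicator E t * t powr (\<gamma> - 1)) \<partial>lebesgue)"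
    unfolding w_meas_def by (intro nn_integral_cong) (auto simp: indicator_def)
  also have "\<dots> = (\<integral>\<^sup>+t. ennreal (indicator E t * t powr (\<gamma> - 1)) \<partial>lborel)"
    using assms(2) by (intro nn_integral_completion) measurable
  also have "\<dots> = ennreal I"
    by (rule nn_integral_has_integral_lebesgue[OF _ assms(1)]) auto
  finally show ?thesis .
qed

lemma w_meas_power_sublevel:
  assumes "\<gamma> \<noteq> 0" "q > 0" "c \<ge> 0"
  shows "w_meas \<gamma> (power_sublevel \<gamma> q c) = ennreal (c powr q / \<bar>\<gamma>\<bar>)"
\<comment> \<open>The cutoff 0 is included because the empty exceptional set is later encoded by it;
  both sides are then 0.\<close>
proof (cases "c = 0")
  case True
  then show ?thesis by (simp add: power_sublevel_nonpos w_meas_def)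
next
  case False
  with assms have c: "c > 0" by simp
  \<comment> \<open>This is t^\<gamma> at the endpoint t = c^(q/\<gamma>), the boundary term of the
    antiderivative t^\<gamma> / \<gamma>.\<close>
  have e: "(c powr (q / \<gamma>)) powr \<gamma> = c powr q" using assms by (simp add: powr_powr)
  show ?thesis
  proof (cases "\<gamma> > 0")
    case True
    have "((\<lambda>t. t powr (\<gamma> - 1)) has_integral (c powr q / \<gamma>)) {0..c powr (q / \<gamma>)}"
      using has_integral_powr_from_0[of "\<gamma> - 1" "c powr (q / \<gamma>)"] True e by simp
    then have "w_meas \<gamma> {0..c powr (q / \<gamma>)} = ennreal (c powr q / \<gamma>)"
      by (rule w_meas_eq_has_integral) simp
    \<comment> \<open>The integrands agree even at t = 0, because
      \<open>0 powr (\<gamma> - 1)\<close> is 0 by convention.\<close>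
    moreover have "w_meas \<gamma> {0<..c powr (q / \<gamma>)} = w_meas \<gamma> {0..c powr (q / \<gamma>)}"
      unfolding w_meas_def by (intro nn_integral_cong) (auto simp: indicator_def)
    ultimately show ?thesis
      using power_sublevel_pos[OF True assms(2) c] True by simp
  next
    case neg: False
    with assms have n: "\<gamma> < 0" by simp
    have "((\<lambda>t. t powr (\<gamma> - 1)) has_integral - (c powr q / \<gamma>)) {c powr (q / \<gamma>)..}"
      using has_integral_powr_to_inf[of "\<gamma> - 1" "c powr (q / \<gamma>)"] n c e by simp
    then have "w_meas \<gamma> {c powr (q / \<gamma>)..} = ennreal (- (c powr q / \<gamma>))"
      by (rule w_meas_eq_has_integral) simp
    then show ?thesis
      using power_sublevel_neg[OF n assms(2) c] n by simp
  qed
qed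

section \<open>Comparing level sets with sublevel sets\<close>

text \<open>On the level set l * t^(\<gamma>/q) < T t, so T t \<le> a forces t^(\<gamma>/q) < a / l.
  Points without such a bound on T are absorbed through c \<le> a / l.\<close>

lemma level_set_subset_power_sublevel:
  assumes "l > 0" "\<And>t. t > 0 \<Longrightarrow> t powr (\<gamma> / q) \<le> c \<or> T t \<le> a" "c \<le> a / l"
  shows "level_set T \<gamma> q l \<subseteq> power_sublevel \<gamma> q (a / l)"
proof
  fix t assume "t \<in> level_set T \<gamma> q l"
  then have t: "t > 0" "l * t powr (\<gamma> / q) < T t"
    by (auto simp: level_set_def pos_less_divide_eq)
  have "t powr (\<gamma> / q) \<le> a / l"
    using assms(2)[OF t(1)]
  proof
    assume "T t \<le> a"
    then show ?thesis using t assms(1) by (simp add: pos_le_divide_eq mult.commute)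
  qed (use assms(3) in simp)
  then show "t \<in> power_sublevel \<gamma> q (a / l)" using t by (simp add: power_sublevel_def)
qed

lemma mem_level_set_of_power_sublevel:
  assumes "t \<in> power_sublevel \<gamma> q (a / l)" "l > 0" "a < T t"
  shows "t \<in> level_set T \<gamma> q l"
proof -
  have "0 < t" "l * t powr (\<gamma> / q) \<le> a"
    using assms by (auto simp: power_sublevel_def pos_le_divide_eq mult.commute)
  then show ?thesis using assms(3) by (auto simp: level_set_def pos_less_divide_eq)
qed

lemma level_set_sets:
  assumes "T \<in> borel_measurable (lebesgue_on {0<..})"
  shows "level_set T \<gamma> q l \<in> sets lebesgue"
proof -
  have p: "(\<lambda>t::real. t powr (\<gamma> / q)) \<in> borel_measurable (lebesgue_on {0<..})"
    by (rule measurable_restrict_space1, rule measurable_completion) measurable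
  have "{t \<in> space (lebesgue_on {0<..}). l < T t / t powr (\<gamma> / q)}
      \<in> sets (lebesgue_on {0<..})"
    using assms p by measurable
  moreover have "{t \<in> space (lebesgue_on {0<..}). l < T t / t powr (\<gamma> / q)} = level_set T \<gamma> q l"
    by (auto simp: level_set_def)
  ultimately show ?thesis
    by (auto simp: sets_restrict_space_iff)
qed

section \<open>Two-sided bounds for the measure of a level set\<close>

lemma weak_quantity_eq:
  assumes "l > 0" "w_meas \<gamma> (level_set T \<gamma> q l) = ennreal x" "x \<ge> 0"
  shows "weak_quantity T \<gamma> q l = ennreal (l * x powr (1 / q))"
  using assms by (simp add: weak_quantity_def ennpowr_def ennreal_mult)

text \<open>The expression l^q * (\<bar>\<gamma>\<bar> * x) is the q-th power of
  \<bar>\<gamma>\<bar>^(1/q) times the weak quantity; bounding it lets limits be taken in the reals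
  before extracting a root. Finiteness of the measure comes from the same comparison.\<close>

lemma w_meas_level_set_le:
  assumes "\<gamma> \<noteq> 0" "q > 0" "l > 0" "a \<ge> 0" "level_set T \<gamma> q l \<subseteq> power_sublevel \<gamma> q (a / l)"
  obtains x where "x \<ge> 0" "w_meas \<gamma> (level_set T \<gamma> q l) = ennreal x"
    "l powr q * (\<bar>\<gamma>\<bar> * x) \<le> a powr q"
proof -
  have le: "w_meas \<gamma> (level_set T \<gamma> q l) \<le> ennreal ((a / l) powr q / \<bar>\<gamma>\<bar>)"
    using w_meas_mono[OF assms(5), of \<gamma>] w_meas_power_sublevel[of \<gamma> q "a / l"] assms by simp
  then obtain x where x: "x \<ge> 0" "w_meas \<gamma> (level_set T \<gamma> q l) = ennreal x"
    by (cases "w_meas \<gamma> (level_set T \<gamma> q l)") (auto simp: top_unique)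
  with le have "x \<le> (a / l) powr q / \<bar>\<gamma>\<bar>" by simp
  then have "l powr q * (\<bar>\<gamma>\<bar> * x) \<le> a powr q"
    using assms by (simp add: powr_divide field_simps)
  with x that show ?thesis by blast
qed

text \<open>Subadditivity applied to the inclusion, then multiplication by l^q *
  \<bar>\<gamma>\<bar>. The exceptional set costs (l * d)^q, which vanishes in the limit as soon as
  l * d does.\<close>

lemma w_meas_level_set_ge:
  assumes "\<gamma> \<noteq> 0" "q > 0" "l > 0" "a \<ge> 0" "d \<ge> 0"
    and "level_set T \<gamma> q l \<in> sets lebesgue"
    and "power_sublevel \<gamma> q (a / l) \<subseteq> level_set T \<gamma> q l \<union> power_sublevel \<gamma> q d"
    and "x \<ge> 0" "w_meas \<gamma> (level_set T \<gamma> q l) = ennreal x"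
  shows "a powr q - (l * d) powr q \<le> l powr q * (\<bar>\<gamma>\<bar> * x)"
proof -
  have "ennreal ((a / l) powr q / \<bar>\<gamma>\<bar>)
      \<le> w_meas \<gamma> (level_set T \<gamma> q l \<union> power_sublevel \<gamma> q d)"
    using w_meas_mono[OF assms(7), of \<gamma>] w_meas_power_sublevel[of \<gamma> q "a / l"] assms by simp
  also have "\<dots> \<le> ennreal x + ennreal (d powr q / \<bar>\<gamma>\<bar>)"
    using w_meas_Un_le[OF assms(6) power_sublevel_sets, of \<gamma> \<gamma> q d] w_meas_power_sublevel[of \<gamma> q d]
      assms by simp
  finally have "(a / l) powr q / \<bar>\<gamma>\<bar> \<le> x + d powr q / \<bar>\<gamma>\<bar>"
    using assms by (simp flip: ennreal_plus)
  then have "(a / l) powr q \<le> \<bar>\<gamma>\<bar> * x + d powr q"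
    using assms(1) by (simp add: field_simps)
  then have "l powr q * (a / l) powr q \<le> l powr q * (\<bar>\<gamma>\<bar> * x + d powr q)"
    by (rule mult_left_mono) simp
  then show ?thesis
    using assms by (simp add: powr_divide powr_mult algebra_simps)
qed

section \<open>Passing to the limit in \<lambda>\<close>

lemma powr_abs_cancel:
  fixes l x g q :: real
  assumes "q > 0" "l > 0" "x \<ge> 0"
  shows "(l powr q * (\<bar>g\<bar> * x)) powr (1 / q) = \<bar>g\<bar> powr (1 / q) * (l * x powr (1 / q))"
  using assms by (simp add: powr_mult powr_powr)

text \<open>The set with parameter \<open>d\<close> collects the points where nothing is known about \<open>T\<close>; it is
  empty (\<open>d = 0\<close>) when \<open>\<lambda> \<rightarrow> \<infinity>\<close>.\<close>

lemma weak_quantity_tendsto: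
  assumes "\<gamma> \<noteq> 0" "q > 0" "L \<ge> 0"
    and meas: "\<And>l. level_set T \<gamma> q l \<in> sets lebesgue"
    and pos: "eventually (\<lambda>l. l > 0) G"
    and upper: "\<And>a. L < a \<Longrightarrow>
      eventually (\<lambda>l. level_set T \<gamma> q l \<subseteq> power_sublevel \<gamma> q (a / l)) G"
    and lower: "\<And>a. 0 < a \<Longrightarrow> a < L \<Longrightarrow> \<exists>d\<ge>0. ((\<lambda>l. l * d) \<longlongrightarrow> 0) G \<and>
      eventually (\<lambda>l. power_sublevel \<gamma> q (a / l) \<subseteq> level_set T \<gamma> q l \<union> power_sublevel \<gamma> q d) G"
  shows "\<exists>M. (weak_quantity T \<gamma> q \<longlongrightarrow> M) G \<and> ennreal L = ennreal (\<bar>\<gamma>\<bar> powr (1 / q)) * M"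
proof -
  \<comment> \<open>\<open>enn2real\<close> turns an infinite measure into 0, so \<open>x\<close> is
    the true measure only where \<open>fin\<close> below holds.\<close>
  define x where "x l = enn2real (w_meas \<gamma> (level_set T \<gamma> q l))" for l
  define g where "g l = l powr q * (\<bar>\<gamma>\<bar> * x l)" for l
  have x0: "x l \<ge> 0" for l by (simp add: x_def)
  have g0: "g l \<ge> 0" for l by (simp add: g_def x0)
  have bound: "eventually (\<lambda>l. w_meas \<gamma> (level_set T \<gamma> q l) = ennreal (x l) \<and> g l \<le> a powr q) G"
    if "L < a" for a
    using upper[OF that] pos
  proof eventually_elim
    case (elim l)
    then show ?case
      using w_meas_level_set_le[of \<gamma> q l a T] assms(1-3) that
      by (metis x_def g_def enn2real_ennreal less_imp_le order_trans)
  qed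
  have fin: "eventually (\<lambda>l. w_meas \<gamma> (level_set T \<gamma> q l) = ennreal (x l)) G"
    using bound[of "L + 1"] by (auto elim: eventually_mono)
  \<comment> \<open>Restricting to a \<ge> 0 covers L = 0 as well, where the continuity rests on q >
    0.\<close>
  have cont: "((\<lambda>a. a powr q) \<longlongrightarrow> L powr q) (at L within {0..})"
    using assms(2,3) by (intro tendsto_powr') (auto simp: eventually_at_filter intro!: tendsto_ident_at)
  have "(g \<longlongrightarrow> L powr q) G"
  proof (rule order_tendstoI)
    fix b assume b: "L powr q < b"
    \<comment> \<open>Some a slightly above L still has a^q < b, and \<open>bound\<close> gives g l
      \<le> a^q eventually.\<close>
    have "eventually (\<lambda>a. a powr q < b) (at_right L)"
      by (rule order_tendstoD(2)[OF tendsto_within_subset[OF cont] b]) (use assms(3) in auto)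
    then have "eventually (\<lambda>a. L < a \<and> a powr q < b) (at_right L)"
      by (auto simp: eventually_at_filter elim: eventually_mono)
    then obtain a where "L < a" "a powr q < b"
      using eventually_happens'[OF trivial_limit_at_right_real] by blast
    then show "eventually (\<lambda>l. g l < b) G"
      using bound[of a] by (auto elim: eventually_mono)
  next
    fix b assume b: "b < L powr q"
    show "eventually (\<lambda>l. b < g l) G"
    \<comment> \<open>If L = 0 there is no a strictly between 0 and L, but then b < 0 \<le> g
      l.\<close>
    proof (cases "L = 0")
      case True
      then have "b < g l" for l
        using b x0[of l] by (simp add: g_def order_less_le_trans)
      then show ?thesis by simp
    next
      case False
      with assms have L: "L > 0" by simp
      have "((\<lambda>a. a powr q) \<longlongrightarrow> L powr q) (at_left L)"
        using L by (intro tendsto_intros) auto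
      from order_tendstoD(1)[OF this b] eventually_at_left_real[OF L]
      have "eventually (\<lambda>a. b < a powr q \<and> a \<in> {0<..<L}) (at_left L)"
        by (rule eventually_conj)
      from eventually_happens'[OF trivial_limit_at_left_real this]
      obtain a where a: "0 < a" "a < L" "b < a powr q"
        by auto
      from lower[OF a(1,2)] obtain d where d: "d \<ge> 0" "((\<lambda>l. l * d) \<longlongrightarrow> 0) G"
        and ev: "eventually (\<lambda>l. power_sublevel \<gamma> q (a / l)
          \<subseteq> level_set T \<gamma> q l \<union> power_sublevel \<gamma> q d) G" by blast
      have "((\<lambda>l. (l * d) powr q) \<longlongrightarrow> 0 powr q) G"
        using d assms(2) pos
        by (intro tendsto_powr') (auto elim: eventually_mono)
      then have "((\<lambda>l. a powr q - (l * d) powr q) \<longlongrightarrow> a powr q - 0) G"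
        by (intro tendsto_intros) auto
      then have "eventually (\<lambda>l. b < a powr q - (l * d) powr q) G"
        using a(3) by (intro order_tendstoD(1)) auto
      then show ?thesis using ev pos fin
      proof eventually_elim
        case (elim l)
        then show ?case
          using w_meas_level_set_ge[of \<gamma> q l a d T "x l"] assms(1,2) a d(1) meas x0[of l]
          by (simp add: g_def)
      qed
    qed
  qed
  \<comment> \<open>Taking q-th roots and dividing by \<bar>\<gamma>\<bar>^(1/q) recovers the weak
    quantity from \<open>g\<close>.\<close>
  then have "((\<lambda>l. g l powr (1 / q)) \<longlongrightarrow> (L powr q) powr (1 / q)) G"
    using assms(2) g0 by (intro tendsto_powr') auto
  then have "((\<lambda>l. g l powr (1 / q) / \<bar>\<gamma>\<bar> powr (1 / q)) \<longlongrightarrow> L / \<bar>\<gamma>\<bar> powr (1 / q)) G"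
    using assms by (intro tendsto_divide) (auto simp: powr_powr)
  then have lim: "((\<lambda>l. ennreal (g l powr (1 / q) / \<bar>\<gamma>\<bar> powr (1 / q)))
      \<longlongrightarrow> ennreal (L / \<bar>\<gamma>\<bar> powr (1 / q))) G"
    by (rule tendsto_ennrealI)
  have "eventually (\<lambda>l. ennreal (g l powr (1 / q) / \<bar>\<gamma>\<bar> powr (1 / q)) = weak_quantity T \<gamma> q l) G"
    using fin pos
  proof eventually_elim
    case (elim l)
    then show ?case
      using weak_quantity_eq[of l \<gamma> T q "x l"] powr_abs_cancel[of q l "x l" \<gamma>] x0[of l] assms(1,2)
      by (simp add: g_def)
  qed
  with lim have "(weak_quantity T \<gamma> q \<longlongrightarrow> ennreal (L / \<bar>\<gamma>\<bar> powr (1 / q))) G"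
    by (rule Lim_transform_eventually)
  moreover have "ennreal L = ennreal (\<bar>\<gamma>\<bar> powr (1 / q)) * ennreal (L / \<bar>\<gamma>\<bar> powr (1 / q))"
    using assms(1,3) by (simp flip: ennreal_mult)
  ultimately show ?thesis by blast
qed

section \<open>The two regimes: \<lambda> to infinity and \<lambda> to 0\<close>

text \<open>The filter \<open>F\<close> stands for t near 0 if \<gamma> > 0 and t near infinity if
  \<gamma> < 0; \<open>small\<close> records that both contain a set where t^(\<gamma>/q) is small.
  The global bound confines the level set to t^(\<gamma>/q) \<le> S / l, so for large l only the
  behaviour of T along \<open>F\<close> matters.\<close>

lemma weak_quantity_tendsto_at_top:
  assumes "\<gamma> \<noteq> 0" "q > 0" "L \<ge> 0"
    and meas: "\<And>l. level_set T \<gamma> q l \<in> sets lebesgue"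
    and bound: "\<And>t. t > 0 \<Longrightarrow> T t \<le> S"
    and lim: "(T \<longlongrightarrow> L) F"
    and small: "\<And>P. eventually P F \<Longrightarrow> \<exists>c>0. \<forall>t>0. t powr (\<gamma> / q) \<le> c \<longrightarrow> P t"
  shows "\<exists>M. (weak_quantity T \<gamma> q \<longlongrightarrow> M) at_top \<and> ennreal L = ennreal (\<bar>\<gamma>\<bar> powr (1 / q)) * M"
proof (rule weak_quantity_tendsto[OF assms(1-3) meas])
  show "eventually (\<lambda>l::real. l > 0) at_top" by (rule eventually_gt_at_top)
next
  fix a assume a: "L < a"
  from small[OF order_tendstoD(2)[OF lim a]]
  obtain c where c: "c > 0" "\<And>t. t > 0 \<Longrightarrow> t powr (\<gamma> / q) \<le> c \<Longrightarrow> T t < a" by blast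
  show "eventually (\<lambda>l. level_set T \<gamma> q l \<subseteq> power_sublevel \<gamma> q (a / l)) at_top"
    using eventually_gt_at_top[of 0] eventually_ge_at_top[of "S / c"]
  proof eventually_elim
    case (elim l)
    then have Sc: "S / l \<le> c" using c(1) by (simp add: field_simps)
    show ?case
    proof
      fix t assume t: "t \<in> level_set T \<gamma> q l"
      then have "t > 0" "T t > l * t powr (\<gamma> / q)"
        by (auto simp: level_set_def pos_less_divide_eq)
      moreover from this bound[of t] have "l * t powr (\<gamma> / q) \<le> S" by linarith
      then have "t powr (\<gamma> / q) \<le> c"
        using Sc elim(1) by (simp add: field_simps) (smt (verit) mult.commute mult_le_cancel_left_pos)
      ultimately show "t \<in> power_sublevel \<gamma> q (a / l)"
        using c(2)[of t] elim(1) by (simp add: power_sublevel_def field_simps)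
    qed
  qed
next
  fix a assume a: "0 < a" "a < L"
  from small[OF order_tendstoD(1)[OF lim a(2)]]
  obtain c where c: "c > 0" "\<And>t. t > 0 \<Longrightarrow> t powr (\<gamma> / q) \<le> c \<Longrightarrow> a < T t" by blast
  \<comment> \<open>From l = a / c on, the whole sublevel set lies where T > a, so no exceptional
    points remain and d = 0 works.\<close>
  have "eventually (\<lambda>l. power_sublevel \<gamma> q (a / l)
      \<subseteq> level_set T \<gamma> q l \<union> power_sublevel \<gamma> q 0) at_top"
    using eventually_gt_at_top[of 0] eventually_ge_at_top[of "a / c"]
  proof eventually_elim
    case (elim l)
    then have "a / l \<le> c" using c(1) by (simp add: field_simps)
    then show ?case
      using c(2) mem_level_set_of_power_sublevel[of _ \<gamma> q a l T] elim(1)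
      by (auto simp: power_sublevel_def)
  qed
  then show "\<exists>d\<ge>0. ((\<lambda>l. l * d) \<longlongrightarrow> 0) at_top \<and> eventually (\<lambda>l. power_sublevel \<gamma> q (a / l)
      \<subseteq> level_set T \<gamma> q l \<union> power_sublevel \<gamma> q d) at_top"
    by (intro exI[of _ 0]) auto
qed

text \<open>Here T is controlled only where t^(\<gamma>/q) > c. The remaining set is independent of
  l: in the upper inclusion it is swallowed once c \<le> a / l, and in the lower one it is the
  exceptional set with d = c, where l * c tends to 0.\<close>

lemma weak_quantity_tendsto_at_right_0:
  assumes "\<gamma> \<noteq> 0" "q > 0" "L \<ge> 0"
    and meas: "\<And>l. level_set T \<gamma> q l \<in> sets lebesgue"
    and lim: "(T \<longlongrightarrow> L) F"
    and large: "\<And>P. eventually P F \<Longrightarrow> \<exists>c>0. \<forall>t>0. c < t powr (\<gamma> / q) \<longrightarrow> P t"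
  shows "\<exists>M. (weak_quantity T \<gamma> q \<longlongrightarrow> M) (at_right 0)
    \<and> ennreal L = ennreal (\<bar>\<gamma>\<bar> powr (1 / q)) * M"
proof (rule weak_quantity_tendsto[OF assms(1-3) meas])
  show "eventually (\<lambda>l::real. l > 0) (at_right 0)" by (rule eventually_at_right_less)
  fix a assume a: "L < a"
  from large[OF order_tendstoD(2)[OF lim a]]
  obtain c where c: "c > 0" "\<And>t. t > 0 \<Longrightarrow> c < t powr (\<gamma> / q) \<Longrightarrow> T t < a" by blast
  have "0 < a / c" using a c(1) assms(3) by simp
  from eventually_at_right_real[OF this]
  show "eventually (\<lambda>l. level_set T \<gamma> q l \<subseteq> power_sublevel \<gamma> q (a / l)) (at_right 0)"
  proof eventually_elim
    case (elim l)
    then have "c \<le> a / l" using c(1) by (simp add: field_simps)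
    then show ?case
      using elim c(2) by (intro level_set_subset_power_sublevel) (auto simp: not_le intro: less_imp_le)
  qed
next
  fix a assume a: "0 < a" "a < L"
  from large[OF order_tendstoD(1)[OF lim a(2)]]
  obtain c where c: "c > 0" "\<And>t. t > 0 \<Longrightarrow> c < t powr (\<gamma> / q) \<Longrightarrow> a < T t" by blast
  have "eventually (\<lambda>l. power_sublevel \<gamma> q (a / l)
      \<subseteq> level_set T \<gamma> q l \<union> power_sublevel \<gamma> q c) (at_right 0)"
    using eventually_at_right_less[of "0::real"]
  proof eventually_elim
    case (elim l)
    then show ?case
      using c(2) mem_level_set_of_power_sublevel[of _ \<gamma> q a l T]
      by (fastforce simp: power_sublevel_def not_le)
  qed
  moreover have "((\<lambda>l. l * c) \<longlongrightarrow> 0) (at_right 0)"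
    by (rule tendsto_mult_left_zero) (rule tendsto_ident_at)
  ultimately show "\<exists>d\<ge>0. ((\<lambda>l. l * d) \<longlongrightarrow> 0) (at_right 0) \<and> eventually (\<lambda>l. power_sublevel \<gamma> q (a / l)
      \<subseteq> level_set T \<gamma> q l \<union> power_sublevel \<gamma> q d) (at_right 0)"
    using c(1) by (intro exI[of _ c]) auto
qed

section \<open>Neighbourhoods of 0 and infinity in terms of powers\<close>

text \<open>Monotonicity of the power, increasing or decreasing with the sign of p, supplies the
  hypotheses \<open>small\<close> and \<open>large\<close> of the two limit lemmas.\<close>

lemma eventually_at_right_0_powr:
  assumes "eventually P (at_right (0::real))"
  shows "p > 0 \<Longrightarrow> \<exists>c>0. \<forall>t>0. t powr p \<le> c \<longrightarrow> P t"
    and "p < 0 \<Longrightarrow> \<exists>c>0. \<forall>t>0. c < t powr p \<longrightarrow> P t"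
proof -
  from assms obtain b where b: "b > 0" "\<And>t. t > 0 \<Longrightarrow> t < b \<Longrightarrow> P t"
    by (auto simp: eventually_at_right_field)
  {
    assume p: "p > 0"
    \<comment> \<open>Halving b is needed because t^p \<le> c is not strict while P is known only
      for t < b.\<close>
    have "P t" if "t > 0" "t powr p \<le> (b / 2) powr p" for t
      using powr_less_mono2[of p "b / 2" t] that b p by (cases "t < b") force+
    then show "\<exists>c>0. \<forall>t>0. t powr p \<le> c \<longrightarrow> P t"
      using b(1) by (intro exI[of _ "(b / 2) powr p"]) simp
  }
  {
    assume p: "p < 0"
    have "P t" if "t > 0" "b powr p < t powr p" for t
      using powr_mono2'[of p b t] that b p by (cases "t < b") force+
    then show "\<exists>c>0. \<forall>t>0. c < t powr p \<longrightarrow> P t"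
      using b(1) by (intro exI[of _ "b powr p"]) simp
  }
qed

lemma eventually_at_top_powr:
  assumes "eventually P (at_top :: real filter)"
  shows "p < 0 \<Longrightarrow> \<exists>c>0. \<forall>t>0. t powr p \<le> c \<longrightarrow> P t"
    and "p > 0 \<Longrightarrow> \<exists>c>0. \<forall>t>0. c < t powr p \<longrightarrow> P t"
proof -
  from assms obtain b0 where b0: "\<And>t. t \<ge> b0 \<Longrightarrow> P t"
    by (auto simp: eventually_at_top_linorder)
  \<comment> \<open>The maximum with 1 makes the threshold positive, as the monotonicity of powers
    requires.\<close>
  define b where "b = max b0 1"
  have b: "b > 0" "\<And>t. t \<ge> b \<Longrightarrow> P t" using b0 by (auto simp: b_def)
  {
    assume p: "p < 0"
    have "P t" if "t > 0" "t powr p \<le> b powr p" for t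
      using powr_less_mono2_neg[of p t b] that b p by (cases "t < b") force+
    then show "\<exists>c>0. \<forall>t>0. t powr p \<le> c \<longrightarrow> P t"
      using b(1) by (intro exI[of _ "b powr p"]) simp
  }
  {
    assume p: "p > 0"
    have "P t" if "t > 0" "b powr p < t powr p" for t
      using powr_mono2[of p t b] that b p by (cases "t < b") force+
    then show "\<exists>c>0. \<forall>t>0. c < t powr p \<longrightarrow> P t"
      using b(1) by (intro exI[of _ "b powr p"]) simp
  }
qed

section \<open>The uniform bound and the final assembly\<close>

lemma weak_quantity_le:
  assumes "\<gamma> \<noteq> 0" "q > 0" "l > 0" "S \<ge> 0" "\<And>t. t > 0 \<Longrightarrow> T t \<le> S"
  shows "ennreal (\<bar>\<gamma>\<bar> powr (1 / q)) * weak_quantity T \<gamma> q l \<le> ennreal S"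
proof -
  \<comment> \<open>With c = 0 no uncontrolled points are left, since T \<le> S holds at every t >
    0.\<close>
  have "level_set T \<gamma> q l \<subseteq> power_sublevel \<gamma> q (S / l)"
    using assms by (intro level_set_subset_power_sublevel[where c = 0]) auto
  then obtain x where x: "x \<ge> 0" "w_meas \<gamma> (level_set T \<gamma> q l) = ennreal x"
    "l powr q * (\<bar>\<gamma>\<bar> * x) \<le> S powr q"
    using w_meas_level_set_le[of \<gamma> q l S T] assms by metis
  have "(l powr q * (\<bar>\<gamma>\<bar> * x)) powr (1 / q) \<le> (S powr q) powr (1 / q)"
    using x assms by (intro powr_mono2) auto
  then have "\<bar>\<gamma>\<bar> powr (1 / q) * (l * x powr (1 / q)) \<le> S"
    using assms x(1) powr_abs_cancel[of q l x \<gamma>] by (simp add: powr_powr)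
  then show ?thesis
    using weak_quantity_eq[OF assms(3) x(2,1)] assms(3)
    by (simp add: ennreal_leI flip: ennreal_mult)
qed

theorem theorem1p2:
  fixes \<gamma> q :: real and T :: "real \<Rightarrow> real"
  assumes "\<gamma> \<noteq> 0"
    and "q > 0"
    and "T \<in> borel_measurable (lebesgue_on {0<..})"
    and "\<And>t. t > 0 \<Longrightarrow> T t \<ge> 0"
    and "bdd_above (T ` {0<..})"
  shows
    "(\<forall>L. (T \<longlongrightarrow> L) (at_right 0) \<longrightarrow>
        (\<gamma> > 0 \<longrightarrow> (\<exists>M. (weak_quantity T \<gamma> q \<longlongrightarrow> M) at_top \<and>
           ennreal L = ennreal (\<gamma> powr (1 / q)) * M)) \<and>
        (\<gamma> < 0 \<longrightarrow> (\<exists>M. (weak_quantity T \<gamma> q \<longlongrightarrow> M) (at_right 0) \<and>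
           ennreal L = ennreal ((- \<gamma>) powr (1 / q)) * M)))
     \<and> (\<forall>L. (T \<longlongrightarrow> L) at_top \<longrightarrow>
        (\<gamma> > 0 \<longrightarrow> (\<exists>M. (weak_quantity T \<gamma> q \<longlongrightarrow> M) (at_right 0) \<and>
           ennreal L = ennreal (\<gamma> powr (1 / q)) * M)) \<and>
        (\<gamma> < 0 \<longrightarrow> (\<exists>M. (weak_quantity T \<gamma> q \<longlongrightarrow> M) at_top \<and>
           ennreal L = ennreal ((- \<gamma>) powr (1 / q)) * M)))
     \<and> ennreal (\<bar>\<gamma>\<bar> powr (1 / q)) * (SUP l\<in>{0<..}. weak_quantity T \<gamma> q l)
         \<le> ennreal (SUP t\<in>{0<..}. T t)"
proof (intro conjI allI impI)
  have meas: "\<And>l. level_set T \<gamma> q l \<in> sets lebesgue"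
    by (rule level_set_sets[OF assms(3)])
  have bound: "T t \<le> (SUP t\<in>{0<..}. T t)" if "t > 0" for t
    using that assms(5) by (intro cSUP_upper) auto
  {
    fix L assume lim: "(T \<longlongrightarrow> L) (at_right 0)"
    \<comment> \<open>Nonnegativity ensures that \<open>ennreal L\<close> does not truncate the
      limit.\<close>
    have L: "L \<ge> 0"
      using assms(4)
      by (intro tendsto_lowerbound[OF lim] eventually_mono[OF eventually_at_right_less]) auto
    \<comment> \<open>As t tends to 0, t^(\<gamma>/q) becomes small for \<gamma> > 0 and large for
      \<gamma> < 0, which selects the regime of \<lambda>; for t tending to infinity the roles are
      exchanged.\<close>
    show "\<exists>M. (weak_quantity T \<gamma> q \<longlongrightarrow> M) at_top \<and> ennreal L = ennreal (\<gamma> powr (1 / q)) * M"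
      if "\<gamma> > 0"
      using weak_quantity_tendsto_at_top[OF assms(1,2) L meas bound lim]
        eventually_at_right_0_powr(1)[of _ "\<gamma> / q"] that assms(2) by simp
    show "\<exists>M. (weak_quantity T \<gamma> q \<longlongrightarrow> M) (at_right 0)
        \<and> ennreal L = ennreal ((- \<gamma>) powr (1 / q)) * M" if "\<gamma> < 0"
      using weak_quantity_tendsto_at_right_0[OF assms(1,2) L meas lim]
        eventually_at_right_0_powr(2)[of _ "\<gamma> / q"] that assms(2) by (simp add: divide_neg_pos)
  }
  {
    fix L assume lim: "(T \<longlongrightarrow> L) at_top"
    have L: "L \<ge> 0"
      using assms(4)
      by (intro tendsto_lowerbound[OF lim] eventually_mono[OF eventually_gt_at_top[of 0]]) auto
    show "\<exists>M. (weak_quantity T \<gamma> q \<longlongrightarrow> M) (at_right 0)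
        \<and> ennreal L = ennreal (\<gamma> powr (1 / q)) * M" if "\<gamma> > 0"
      using weak_quantity_tendsto_at_right_0[OF assms(1,2) L meas lim]
        eventually_at_top_powr(2)[of _ "\<gamma> / q"] that assms(2) by simp
    show "\<exists>M. (weak_quantity T \<gamma> q \<longlongrightarrow> M) at_top
        \<and> ennreal L = ennreal ((- \<gamma>) powr (1 / q)) * M" if "\<gamma> < 0"
      using weak_quantity_tendsto_at_top[OF assms(1,2) L meas bound lim]
        eventually_at_top_powr(1)[of _ "\<gamma> / q"] that assms(2) by (simp add: divide_neg_pos)
  }
  have "0 \<le> (SUP t\<in>{0<..}. T t)"
    using assms(4)[of 1] bound[of 1] by simp
  then show "ennreal (\<bar>\<gamma>\<bar> powr (1 / q)) * (SUP l\<in>{0<..}. weak_quantity T \<gamma> q l)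
      \<le> ennreal (SUP t\<in>{0<..}. T t)"
    using weak_quantity_le[OF assms(1,2) _ _ bound]
    by (simp add: SUP_mult_left_ennreal SUP_le_iff)
qed

end
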